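(* Let $g_k\in\mathbb{R}^n\setminus\{0\}$, let $B_k\in\mathbb{R}^{n\times n}$ be symmetric, let $M_k\in\mathbb{R}^{n\times n}$ be symmetric positive definite, let $\Delta_k>0$, and let $s_k^Q$ satisfy $B_ks_k^Q=-g_k$ and $|g_k^\top s_k^Q|\ge\epsilon_d\|g_k\|\,\|s_k^Q\|$, where $\epsilon_d>0$ is a pre-defined constant. Consider the trust-region subproblem $$\min_{p\in\mathbb{R}^n}m_k^Q(p)\quad\text{s.t. }\|p\|_{M_k}\le\Delta_k,$$ and let $p_k^{N}$ be the associated Newton-like step defined in the context. 1. The Newton-like step is of the form $$p_k^{N}=\alpha_k^{N}s_k^Q,\qquad\alpha_k^{N}=\min\left\{1,\,-\mathrm{sgn}(g_k^\top s_k^Q)\frac{\Delta_k}{\|s_k^Q\|_{M_k}}\right\}.$$ 2. When it lies on the border of the trust region, $p_k^{N}$ is a stationary point of the trust-region subproblem if and only if $M_ks_k^Q=\frac{\theta_k}{g_k^\top s_k^Q}g_k$, where $\theta_k=\|s_k^Q\|_{M_k}^2$. 3. Let $$\lambda_k^{N}=\frac{g_k^\top s_k^Q}{\theta_k}\left(1+\mathrm{sgn}(g_k^\top s_k^Q)\frac{\|s_k^Q\|_{M_k}}{\Delta_k}\right),\qquad\theta_k=\|s_k^Q\|_{M_k}^2,$$ and assume that $p_k^{N}$ lies on the border of the trust region. Then, if the matrix $B_k+\lambda_k^{N}M_k$ is positive definite, the step $p_k^{N}$ is the unique minimizer of the trust-region subproblem over the subspace $\mathcal{L}_k$ (here $\mathcal{L}_k=\mathbb{R}^n$,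 since $s_k^Q$ is computed exactly).
   Context: $\|\cdot\|$ is the Euclidean norm, $\|x\|_{M_k}=\sqrt{x^\top M_kx}$, and $\mathrm{sgn}$ is the sign of a real number. Here $f:\mathbb{R}^n\to\mathbb{R}$ is continuously differentiable, $x_k\in\mathbb{R}^n$ is the current iterate, $g_k=\nabla f(x_k)\neq0$, and $m_k^Q(p)=f(x_k)+p^\top g_k+\tfrac12p^\top B_kp$. In general $\mathcal{L}_k$ denotes the subspace of $\mathbb{R}^n$ over which the stationary point $s_k^Q$ of $m_k^Q$ is computed; it is all of $\mathbb{R}^n$ when $s_k^Q$ solves $B_ks=-g_k$ exactly, as assumed here. Newton-like step for the trust-region subproblem: $p_k^{N}=\alpha_k^{N}s_k^Q$ with $\alpha_k^{N}=\arg\min_{\alpha\in\mathcal{R}_k}m_k^Q(\alpha s_k^Q)$, where $\mathcal{R}_k=\left(0,\frac{\Delta_k}{\|s_k^Q\|_{M_k}}\right]$ if $g_k^\top s_k^Q<0$ and $\mathcal{R}_k=\left[-\frac{\Delta_k}{\|s_k^Q\|_{M_k}},0\right)$ otherwise. "Lies on the border of the trust region" means $\|p_k^{N}\|_{M_k}=\Delta_k$, i.e. $p_k^{N}=-\mathrm{sgn}(g_k^\top s_k^Q)\frac{\Delta_k}{\|s_k^Q\|_{M_k}}s_k^Q$. A border point $p$ is a stationary point of the subproblem if there is a Lagrange multiplier $\lambda\ge0$ with $(B_k+\lambda M_k)p=-g_k$.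
   Formalization: In part 2 the "only if" direction is stated only for p_k^N ≠ s_k^Q (it fails when the full step s_k^Q lies on the border), and part 3 additionally assumes that p_k^N is a stationary point of the subproblem, without which it is false. *)

theory Defs
  imports "HOL-Analysis.Analysis"
begin

definition pos_def :: "real ^ 'n ^ 'n \<Rightarrow> bool" where
  "pos_def A \<longleftrightarrow> transpose A = A \<and> (\<forall>x. x \<noteq> 0 \<longrightarrow> 0 < x \<bullet> (A *v x))"

definition mnorm :: "real ^ 'n ^ 'n \<Rightarrow> real ^ 'n \<Rightarrow> real" where
  "mnorm M x = sqrt (x \<bullet> (M *v x))"

(* c is the value f(x_k) of the objective at the current iterate. *)
definition quad_model ::
  "real \<Rightarrow> real ^ 'n \<Rightarrow> real ^ 'n ^ 'n \<Rightarrow> real ^ 'n \<Rightarrow> real" where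
  "quad_model c g B p = c + p \<bullet> g + 1 / 2 * (p \<bullet> (B *v p))"

definition trust_region :: "real ^ 'n ^ 'n \<Rightarrow> real \<Rightarrow> (real ^ 'n) set" where
  "trust_region M \<Delta> = {p. mnorm M p \<le> \<Delta>}"

definition newton_range ::
  "real ^ 'n \<Rightarrow> real ^ 'n ^ 'n \<Rightarrow> real \<Rightarrow> real ^ 'n \<Rightarrow> real set" where
  "newton_range g M \<Delta> s =
     (if g \<bullet> s < 0 then {0 <.. \<Delta> / mnorm M s} else {- (\<Delta> / mnorm M s) ..< 0})"

(* The range is not closed, so arg_min yields an unspecified value unless the minimum
   over it is attained. *)
definition newton_alpha ::
  "real \<Rightarrow> real ^ 'n \<Rightarrow> real ^ 'n ^ 'n \<Rightarrow> real ^ 'n ^ 'n \<Rightarrow> real \<Rightarrow> real ^ 'n \<Rightarrow> real" where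
  "newton_alpha c g B M \<Delta> s =
     arg_min (\<lambda>\<alpha>. quad_model c g B (\<alpha> *\<^sub>R s)) (\<lambda>\<alpha>. \<alpha> \<in> newton_range g M \<Delta> s)"

definition newton_step ::
  "real \<Rightarrow> real ^ 'n \<Rightarrow> real ^ 'n ^ 'n \<Rightarrow> real ^ 'n ^ 'n \<Rightarrow> real \<Rightarrow> real ^ 'n \<Rightarrow> real ^ 'n" where
  "newton_step c g B M \<Delta> s = newton_alpha c g B M \<Delta> s *\<^sub>R s"

(* Stationarity of a border point p, i.e. one with mnorm M p = \<Delta>; complementary slackness
   is then automatic, and the multiplier may be zero. *)
definition border_stationary ::
  "real ^ 'n \<Rightarrow> real ^ 'n ^ 'n \<Rightarrow> real ^ 'n ^ 'n \<Rightarrow> real ^ 'n \<Rightarrow> bool" where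
  "border_stationary g B M p \<longleftrightarrow> (\<exists>\<mu>\<ge>0. (B + \<mu> *\<^sub>R M) *v p = - g)"

end

theory Submission
  imports Defs
begin

text \<open>
  Along the line spanned by \<open>s\<close> the model is \<open>c + d * (\<alpha> - \<alpha>\<^sup>2 / 2)\<close> with \<open>d = g \<bullet> s\<close>, because
  \<open>s \<bullet> (B *v s) = - d\<close>; this parabola has vertex \<open>1\<close> and its opening is governed by the sign of \<open>d\<close>.
  At a border point \<open>p = a *\<^sub>R s\<close> stationarity with multiplier \<open>\<mu>\<close> reads
  \<open>(\<mu> * a) *\<^sub>R (M *v s) = (a - 1) *\<^sub>R g\<close>. Pairing with \<open>s\<close> gives \<open>\<mu> * a * \<theta> = (a - 1) * d\<close>, so
  the only possible multiplier is \<open>lamN\<close>, and minimality follows by completing the square in the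
  Lagrangian.
\<close>

lemma dot_matrix_mult_sym:
  fixes A :: "real ^ 'n ^ 'n"
  assumes "transpose A = A"
  shows "x \<bullet> (A *v y) = y \<bullet> (A *v x)"
  by (metis assms dot_lmul_matrix inner_commute transpose_matrix_vector)

lemma pos_def_mnorm_pos:
  assumes "pos_def M" "x \<noteq> 0"
  shows "0 < mnorm M x"
  using assms by (simp add: pos_def_def mnorm_def)

lemma pos_def_mnorm_square:
  assumes "pos_def M"
  shows "(mnorm M x)\<^sup>2 = x \<bullet> (M *v x)"
proof -
  have "0 \<le> x \<bullet> (M *v x)"
    using assms by (cases "x = 0") (auto simp: pos_def_def intro: less_imp_le)
  then show ?thesis
    by (simp add: mnorm_def)
qed

lemma mnorm_scaleR: "mnorm M (a *\<^sub>R x) = \<bar>a\<bar> * mnorm M x"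
proof -
  have "(a *\<^sub>R x) \<bullet> (M *v (a *\<^sub>R x)) = a\<^sup>2 * (x \<bullet> (M *v x))"
    by (simp add: matrix_vector_mult_scaleR power2_eq_square)
  then show ?thesis
    by (simp add: mnorm_def real_sqrt_mult)
qed

text \<open>By \<open>p\<close>, the gradient at \<open>p\<close> of the Lagrangian
  \<open>quad_model c g B q + \<mu> / 2 * (q \<bullet> (M *v q))\<close> vanishes, so its exact
  expansion there has only the quadratic term. The last summand takes the multiplier terms off
  again.\<close>

lemma quad_model_diff:
  fixes B M :: "real ^ 'n ^ 'n"
  assumes B: "transpose B = B" and M: "transpose M = M"
    and p: "(B + \<mu> *\<^sub>R M) *v p = - g"
  shows "quad_model c g B q - quad_model c g B p =
    1 / 2 * ((q - p) \<bullet> ((B + \<mu> *\<^sub>R M) *v (q - p))) + \<mu> / 2 * (p \<bullet> (M *v p) - q \<bullet> (M *v q))"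
proof -
  have g: "g = - (B *v p + \<mu> *\<^sub>R (M *v p))"
    using p by (simp add: matrix_vector_mult_add_rdistrib scaleR_matrix_vector_assoc)
  have "p \<bullet> (B *v q) = q \<bullet> (B *v p)" "p \<bullet> (M *v q) = q \<bullet> (M *v p)"
    using dot_matrix_mult_sym[OF B] dot_matrix_mult_sym[OF M] by blast+
  then show ?thesis
    unfolding quad_model_def g
    by (simp add: matrix_vector_mult_add_rdistrib matrix_vector_mult_diff_distrib
        flip: scaleR_matrix_vector_assoc)
      (simp add: inner_diff_left inner_diff_right inner_add_right algebra_simps; simp add: field_simps)
qed

text \<open>On the trust region \<open>q \<bullet> (M *v q)\<close> is at most its value at the
  border point \<open>p\<close>, so \<mu> \<ge> 0 makes the slack term of
  \<open>quad_model_diff\<close> nonnegative, and the positive definite shifted matrix makes the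
  other term strictly positive for \<open>q \<noteq> p\<close>.\<close>

lemma border_stationary_unique_minimizer:
  fixes B M :: "real ^ 'n ^ 'n"
  assumes B: "transpose B = B" and M: "pos_def M" and H: "pos_def (B + \<mu> *\<^sub>R M)"
    and \<mu>: "0 \<le> \<mu>" and p: "(B + \<mu> *\<^sub>R M) *v p = - g" and border: "mnorm M p = \<Delta>"
  shows "is_arg_min (quad_model c g B) (\<lambda>q. q \<in> trust_region M \<Delta>) q \<longleftrightarrow> q = p"
proof -
  have less: "quad_model c g B p < quad_model c g B q" if "q \<in> trust_region M \<Delta>" "q \<noteq> p" for q
  proof -
    have "0 \<le> mnorm M q"
      using pos_def_mnorm_pos[OF M, of q] by (cases "q = 0") (auto simp: mnorm_def)
    then have "(mnorm M q)\<^sup>2 \<le> (mnorm M p)\<^sup>2"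
      using that(1) border by (auto simp: trust_region_def intro: power_mono)
    then have "0 \<le> \<mu> / 2 * (p \<bullet> (M *v p) - q \<bullet> (M *v q))"
      using \<mu> by (simp add: pos_def_mnorm_square[OF M])
    moreover have "0 < (q - p) \<bullet> ((B + \<mu> *\<^sub>R M) *v (q - p))"
      using H that(2) by (simp add: pos_def_def)
    ultimately show ?thesis
      using quad_model_diff[OF B _ p, of c q] M by (simp add: pos_def_def)
  qed
  have "p \<in> trust_region M \<Delta>"
    using border by (simp add: trust_region_def)
  then show ?thesis
    using less by (metis is_arg_min_def less_asym)
qed

lemma quad_model_line:
  assumes "B *v s = - g"
  shows "quad_model c g B (\<alpha> *\<^sub>R s) = c + (g \<bullet> s) * (\<alpha> - \<alpha>\<^sup>2 / 2)"
  using assms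
  by (simp add: quad_model_def matrix_vector_mult_scaleR inner_commute power2_eq_square algebra_simps)

text \<open>For \<open>g \<bullet> s < 0\<close> the parabola is convex with vertex 1, so its
  minimizer is 1 cut off at the right end. For \<open>g \<bullet> s > 0\<close> it is concave and
  strictly increasing on the negative axis, so the left end is optimal. Either point lies in the
  half-open range, so the minimum is attained.\<close>

lemma newton_alpha_eq:
  fixes B M :: "real ^ 'n ^ 'n"
  assumes Bs: "B *v s = - g" and d: "g \<bullet> s \<noteq> 0" and N: "0 < mnorm M s" and \<Delta>: "0 < \<Delta>"
  shows "newton_alpha c g B M \<Delta> s = min 1 (- sgn (g \<bullet> s) * (\<Delta> / mnorm M s))"
proof -
  define r where "r = \<Delta> / mnorm M s"
  have r: "0 < r"
    using N \<Delta> by (simp add: r_def)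
  define a where "a = min 1 (- sgn (g \<bullet> s) * r)"
  have a_range: "a \<in> newton_range g M \<Delta> s"
    using r d by (auto simp: newton_range_def a_def sgn_if r_def[symmetric])
  have less: "quad_model c g B (a *\<^sub>R s) < quad_model c g B (\<alpha> *\<^sub>R s)"
    if \<alpha>: "\<alpha> \<in> newton_range g M \<Delta> s" and "\<alpha> \<noteq> a" for \<alpha>
  proof -
    \<comment> \<open>The factor \<open>2 - \<alpha> - a\<close> reflects the symmetry of the
      parabola about its vertex 1.\<close>
    have eq: "quad_model c g B (\<alpha> *\<^sub>R s) - quad_model c g B (a *\<^sub>R s)
        = (g \<bullet> s) * ((\<alpha> - a) * (2 - \<alpha> - a) / 2)"
      by (simp add: quad_model_line[OF Bs] power2_eq_square field_simps)
    have "0 < (g \<bullet> s) * ((\<alpha> - a) * (2 - \<alpha> - a) / 2)"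
    proof (cases "g \<bullet> s < 0")
      case True
      then have "a = min 1 r" "0 < \<alpha>" "\<alpha> \<le> r"
        using \<alpha> by (auto simp: a_def newton_range_def r_def)
      \<comment> \<open>If \<open>r \<le> 1\<close>, then \<open>\<alpha> < a = r\<close> and the
        factors have opposite signs; otherwise \<open>a = 1\<close> and the product is minus the
        square of \<open>\<alpha> - 1\<close>.\<close>
      then have "(\<alpha> - a) * (2 - \<alpha> - a) < 0"
        using \<open>\<alpha> \<noteq> a\<close> by (cases "r \<le> 1") (auto simp: mult_less_0_iff min_def)
      then show ?thesis
        using True by (simp add: zero_less_mult_iff)
    next
      case False
      then have "a = - r" "- r \<le> \<alpha>" "\<alpha> < 0"
        using \<alpha> r d by (auto simp: a_def newton_range_def r_def)
      then show ?thesis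
        using False d r \<open>\<alpha> \<noteq> a\<close> by (auto simp: zero_less_mult_iff)
    qed
    then show ?thesis
      using eq by linarith
  qed
  have "newton_alpha c g B M \<Delta> s = a"
    unfolding newton_alpha_def arg_min_def
  proof (rule some_equality)
    show "is_arg_min (\<lambda>\<alpha>. quad_model c g B (\<alpha> *\<^sub>R s)) (\<lambda>\<alpha>. \<alpha> \<in> newton_range g M \<Delta> s) a"
      unfolding is_arg_min_def using a_range less by (metis less_asym less_irrefl)
  next
    fix \<alpha>
    assume "is_arg_min (\<lambda>\<alpha>. quad_model c g B (\<alpha> *\<^sub>R s)) (\<lambda>\<alpha>. \<alpha> \<in> newton_range g M \<Delta> s) \<alpha>"
    then show "\<alpha> = a"
      unfolding is_arg_min_def using a_range less by metis
  qed
  then show ?thesis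
    by (simp add: a_def r_def)
qed

lemma stationary_on_line_iff:
  fixes B M :: "real ^ 'n ^ 'n"
  assumes "B *v s = - g"
  shows "(B + \<mu> *\<^sub>R M) *v (a *\<^sub>R s) = - g \<longleftrightarrow> (\<mu> * a) *\<^sub>R (M *v s) = (a - 1) *\<^sub>R g"
proof -
  have "(B + \<mu> *\<^sub>R M) *v (a *\<^sub>R s) + g = (\<mu> * a) *\<^sub>R (M *v s) - (a - 1) *\<^sub>R g"
    using assms
    by (simp add: matrix_vector_mult_add_rdistrib matrix_vector_mult_scaleR algebra_simps
        flip: scaleR_matrix_vector_assoc)
  then show ?thesis
    by (metis add_eq_0_iff2 right_minus_eq)
qed

text \<open>If \<open>p = s\<close>, the multiplier 0 gives stationarity whatever \<open>M\<close>
  is, so parallelism of \<open>M *v s\<close> and \<open>g\<close> is concluded only for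
  \<open>p \<noteq> s\<close>. The minimality claim assumes stationarity: every minimizer on the
  border has it, but positive definiteness of the shifted matrix does not force it.\<close>

theorem theorem5p1:
  fixes f :: "real ^ 'n \<Rightarrow> real" and gradf :: "real ^ 'n \<Rightarrow> real ^ 'n"
    and x g s p :: "real ^ 'n" and B M :: "real ^ 'n ^ 'n"
    and \<Delta> \<epsilon>\<^sub>d \<theta> lamN :: real
  assumes grad: "\<And>y. GDERIV f y :> gradf y"
    and C1: "continuous_on UNIV gradf"
    and g: "g = gradf x" and g_nz: "g \<noteq> 0"
    and B_sym: "transpose B = B"
    and M_pd: "pos_def M"
    and Delta: "0 < \<Delta>"
    and s: "B *v s = - g"
    and eps: "0 < \<epsilon>\<^sub>d" and descent: "\<epsilon>\<^sub>d * norm g * norm s \<le> \<bar>g \<bullet> s\<bar>"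
    and p: "p = newton_step (f x) g B M \<Delta> s"
    and theta: "\<theta> = (mnorm M s)\<^sup>2"
    and lamN: "lamN = (g \<bullet> s) / \<theta> * (1 + sgn (g \<bullet> s) * (mnorm M s / \<Delta>))"
  shows
    "(newton_alpha (f x) g B M \<Delta> s = min 1 (- sgn (g \<bullet> s) * (\<Delta> / mnorm M s))
        \<and> p = min 1 (- sgn (g \<bullet> s) * (\<Delta> / mnorm M s)) *\<^sub>R s)
     \<and> (mnorm M p = \<Delta> \<longrightarrow>
          (p \<noteq> s \<longrightarrow> (border_stationary g B M p \<longleftrightarrow> M *v s = (\<theta> / (g \<bullet> s)) *\<^sub>R g))
          \<and> (M *v s = (\<theta> / (g \<bullet> s)) *\<^sub>R g \<longrightarrow> border_stationary g B M p))
     \<and> (mnorm M p = \<Delta> \<and> border_stationary g B M p \<and> pos_def (B + lamN *\<^sub>R M) \<longrightarrow>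
          (\<forall>q. is_arg_min (quad_model (f x) g B) (\<lambda>q. q \<in> trust_region M \<Delta>) q \<longleftrightarrow> q = p))"
proof -
  define d where "d = g \<bullet> s"
  define N where "N = mnorm M s"
  define a where "a = min 1 (- sgn d * (\<Delta> / N))"
  have s_nz: "s \<noteq> 0"
    using s g_nz by auto
  \<comment> \<open>The angle condition keeps \<open>g \<bullet> s\<close> away from zero, so its
    sign is proper and division by it is meaningful.\<close>
  have "0 < \<epsilon>\<^sub>d * norm g * norm s"
    using eps g_nz s_nz by simp
  then have d_nz: "d \<noteq> 0"
    using descent by (auto simp: d_def)
  have N: "0 < N"
    using pos_def_mnorm_pos[OF M_pd s_nz] by (simp add: N_def)
  have \<theta>: "\<theta> = s \<bullet> (M *v s)" "0 < \<theta>"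
    using theta N pos_def_mnorm_square[OF M_pd, of s] by (simp add: N_def, metis N_def zero_less_power)
  have alpha: "newton_alpha (f x) g B M \<Delta> s = a"
    using newton_alpha_eq[OF s, of M \<Delta> "f x"] d_nz N Delta by (simp add: a_def d_def N_def)
  have p_eq: "p = a *\<^sub>R s"
    using p alpha by (simp add: newton_step_def)
  have a_le: "a \<le> 1"
    by (simp add: a_def)
  have a_d: "a * d < 0"
    using d_nz N Delta by (cases "d < 0") (auto simp: a_def mult_less_0_iff min_less_iff_disj)
  then have a_nz: "a \<noteq> 0"
    by auto
  \<comment> \<open>This is the only candidate multiplier. Expanding the fraction by
    \<open>a\<close> reduces its sign to \<open>a \<le> 1\<close> and the descent property
    \<open>a * d < 0\<close>.\<close>
  have mult_nonneg: "0 \<le> (a - 1) * d / (a * \<theta>)"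
  proof -
    have "0 \<le> (a - 1) * (a * d)"
      using a_le a_d by (simp add: zero_le_mult_iff)
    then have "0 \<le> (a - 1) * (a * d) / (a\<^sup>2 * \<theta>)"
      using \<theta>(2) by simp
    also have "\<dots> = (a - 1) * d / (a * \<theta>)"
      using a_nz by (simp add: power2_eq_square)
    finally show ?thesis .
  qed
  have multiplier: "\<mu> = (a - 1) * d / (a * \<theta>)" if "(\<mu> * a) *\<^sub>R (M *v s) = (a - 1) *\<^sub>R g" for \<mu>
  proof -
    have "s \<bullet> ((\<mu> * a) *\<^sub>R (M *v s)) = s \<bullet> ((a - 1) *\<^sub>R g)"
      by (simp only: that)
    then have "\<mu> * a * \<theta> = (a - 1) * d"
      by (simp add: \<theta>(1) d_def inner_commute)
    then show ?thesis
      using a_nz \<theta>(2) by (simp add: field_simps)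
  qed
  have stationary_if: "border_stationary g B M p" if "M *v s = (\<theta> / d) *\<^sub>R g"
  proof -
    have "((a - 1) * d / (a * \<theta>) * a) *\<^sub>R (M *v s) = (a - 1) *\<^sub>R g"
      using that a_nz \<theta>(2) d_nz by simp
    then show ?thesis
      using mult_nonneg unfolding border_stationary_def p_eq stationary_on_line_iff[OF s] by blast
  qed
  have parallel: "M *v s = (\<theta> / d) *\<^sub>R g" if stat: "border_stationary g B M p" and "p \<noteq> s"
  proof -
    obtain \<mu> where \<mu>: "(\<mu> * a) *\<^sub>R (M *v s) = (a - 1) *\<^sub>R g"
      using stat unfolding border_stationary_def p_eq stationary_on_line_iff[OF s] by blast
    \<comment> \<open>This permits cancelling \<open>a - 1\<close>; at \<open>a = 1\<close> the
      equation is trivial and says nothing about \<open>M *v s\<close>.\<close>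
    have "a \<noteq> 1"
      using that(2) p_eq by auto
    have "\<mu> * a = (a - 1) * (d / \<theta>)"
      unfolding multiplier[OF \<mu>] using a_nz by simp
    then have "(a - 1) *\<^sub>R ((d / \<theta>) *\<^sub>R (M *v s)) = (a - 1) *\<^sub>R g"
      using \<mu> by (simp only: scaleR_scaleR)
    then have "(d / \<theta>) *\<^sub>R (M *v s) = g"
      using \<open>a \<noteq> 1\<close> unfolding scaleR_cancel_left by simp
    then have "(\<theta> / d) *\<^sub>R (d / \<theta>) *\<^sub>R (M *v s) = (\<theta> / d) *\<^sub>R g"
      by (rule arg_cong)
    then show ?thesis
      using d_nz \<theta>(2) by simp
  qed
  have minimizer: "is_arg_min (quad_model (f x) g B) (\<lambda>q. q \<in> trust_region M \<Delta>) q \<longleftrightarrow> q = p"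
    if border: "mnorm M p = \<Delta>" and stat: "border_stationary g B M p"
      and H: "pos_def (B + lamN *\<^sub>R M)" for q
  proof -
    obtain \<mu> where \<mu>: "0 \<le> \<mu>" "(B + \<mu> *\<^sub>R M) *v p = - g"
      using stat unfolding border_stationary_def by blast
    have "\<bar>a\<bar> = \<Delta> / N"
      using border N by (simp add: p_eq mnorm_scaleR N_def[symmetric] field_simps)
    \<comment> \<open>The border fixes the modulus of \<open>a\<close> and descent its sign. Since
      \<open>sgn d\<close> is its own inverse, \<open>lamN\<close> then turns into the candidate
      multiplier and hence equals \<mu>, which makes it nonnegative.\<close>
    then have "a = - sgn d * (\<Delta> / N)"
      using a_d by (cases "d < 0") (auto simp: mult_less_0_iff)
    then have "1 / a = - sgn d * (N / \<Delta>)"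
      using d_nz by (simp add: sgn_if)
    then have "lamN = d / \<theta> * (1 - 1 / a)"
      using lamN by (simp add: d_def N_def)
    also have "\<dots> = (a - 1) * d / (a * \<theta>)"
      using a_nz by (simp add: field_simps)
    also have "\<dots> = \<mu>"
      using multiplier \<mu>(2) unfolding p_eq stationary_on_line_iff[OF s] by metis
    finally have "lamN = \<mu>" .
    then show ?thesis
      using border_stationary_unique_minimizer[OF B_sym M_pd _ \<mu> border] H by simp
  qed
  show ?thesis
    using alpha p_eq stationary_if parallel minimizer unfolding a_def d_def N_def by blast
qed

end
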